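(* Let $G$ be a finite group and let $\mathcal{O}$ be a $G$-transfer system. The maximal compatible transfer system $\mathrm{M}(\mathcal{O})$ admits the recursive formula $$\mathrm{M}(\mathcal{O}) = \{ e \in \mathcal{O} \mid \text{for all } r \in \mathcal{O} \text{ with } r<e,\ r\in \mathrm{M}(\mathcal{O}) \text{ and } r<^S e\}.$$ Furthermore, if $\mathcal{O}$ is disklike, then it suffices to check cover relations of the restriction poset: $$\mathrm{M}(\mathcal{O}) = \{ e \in \mathcal{O} \mid \text{for all } r \in \mathcal{O} \text{ with } r\prec e,\ r \in \mathrm{M}(\mathcal{O}) \text{ and } r\prec^S e\}.$$
   Context: $G$ is a finite group. A $G$-transfer system $\mathcal{O}$ is a binary relation $\to$ on the set of subgroups of $G$, refining inclusion ($K\to H$ implies $K\le H$), such that: $H\to H$ for all $H\le G$; $K\to H$ implies $gKg^{-1}\to gHg^{-1}$ for all $g\in G$; $K\to H$ and $L\le H$ imply $K\cap L\to L$; and $L\to K$, $K\to H$ imply $L\to H$. Its elements $K\to H$ are called transfers. Transfer systems are ordered by containment. $\mathcal{O}$ is disklike if it is generated by transfers with target $G$, i.e. it is the smallest $G$-transfer system containing some set of pairs of the form $H\to G$ (equivalently, every transfer of $\mathcal{O}$ is $H\cap L\to L$ for some $H\to G$ in $\mathcal{O}$ and $L\le G$). A pair $(\mathcal{O}_a,\mathcal{O}_m)$ of $G$-transfer systems is compatible if $\mathcal{O}_m\subseteq\mathcal{O}_a$ and, for all $K,J\le H\le G$, if $K\to H$ is in $\mathcal{O}_m$ and $K\cap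 J\to K$ is in $\mathcal{O}_a$, then $J\to H$ is in $\mathcal{O}_a$. For every $G$-transfer system $\mathcal{O}$ there is a unique largest $G$-transfer system $\mathrm{M}(\mathcal{O})$ such that $(\mathcal{O},\mathrm{M}(\mathcal{O}))$ is compatible; it is called the maximal compatible transfer system of $\mathcal{O}$. Restriction poset: for transfers $r,e\in\mathcal{O}$ with $e\colon K\to H$, write $r\le e$ if $r$ is the transfer $K\cap J\to J$ for some $J\le H$; this is a partial order on the transfers of $\mathcal{O}$. Write $r<e$ if $r\le e$ and $r\ne e$, and $r\prec e$ if $r<e$ is a covering relation. For $r\colon K\cap J\to J$ with $r\le e$, the relation is a compatibility success, written $r\le^S e$, if ($K\cap J\to K$ in $\mathcal{O}$ implies $J\to H$ in $\mathcal{O}$). Write $r<^S e$ if $r<e$ and $r\le^S e$, and $r\prec^S e$ if $r\prec e$ and $r\le^S e$. *)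

theory Defs
  imports "HOL-Algebra.Algebra" "HOL.Hull"
begin

text \<open>
  A transfer \<open>K \<rightarrow> H\<close> is the pair \<open>(K, H)\<close> of subgroups, each given by its carrier set.
\<close>

definition transfer_system :: "('a, 'b) monoid_scheme \<Rightarrow> ('a set \<times> 'a set) set \<Rightarrow> bool" where
  "transfer_system G T \<longleftrightarrow>
     T \<subseteq> {(K, H). subgroup K G \<and> subgroup H G \<and> K \<subseteq> H} \<and>
     refl_on {H. subgroup H G} T \<and>
     (\<forall>K H. \<forall>g \<in> carrier G. (K, H) \<in> T \<longrightarrow>
        (g <#\<^bsub>G\<^esub> K #>\<^bsub>G\<^esub> inv\<^bsub>G\<^esub> g, g <#\<^bsub>G\<^esub> H #>\<^bsub>G\<^esub> inv\<^bsub>G\<^esub> g) \<in> T) \<and>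
     (\<forall>K H L. (K, H) \<in> T \<and> subgroup L G \<and> L \<subseteq> H \<longrightarrow> (K \<inter> L, L) \<in> T) \<and>
     trans T"

text \<open>
  Transfer systems on a group are closed under arbitrary intersection (the empty intersection
  being replaced by the full inclusion relation), so the hull is the smallest transfer system
  containing the given set.
\<close>

definition disklike :: "('a, 'b) monoid_scheme \<Rightarrow> ('a set \<times> 'a set) set \<Rightarrow> bool" where
  "disklike G T \<longleftrightarrow>
     (\<exists>S \<subseteq> {(H, carrier G) | H. subgroup H G}. T = transfer_system G hull S)"

definition compatible ::
  "('a, 'b) monoid_scheme \<Rightarrow> ('a set \<times> 'a set) set \<Rightarrow> ('a set \<times> 'a set) set \<Rightarrow> bool" where
  "compatible G A M \<longleftrightarrow>
     transfer_system G A \<and> transfer_system G M \<and> M \<subseteq> A \<and>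
     (\<forall>K J H. subgroup K G \<and> subgroup J G \<and> subgroup H G \<and> K \<subseteq> H \<and> J \<subseteq> H \<and>
        (K, H) \<in> M \<and> (K \<inter> J, K) \<in> A \<longrightarrow> (J, H) \<in> A)"

text \<open>The greatest element is taken with respect to \<open>\<subseteq>\<close>.\<close>

definition max_compatible ::
  "('a, 'b) monoid_scheme \<Rightarrow> ('a set \<times> 'a set) set \<Rightarrow> ('a set \<times> 'a set) set" where
  "max_compatible G T = (GREATEST M. compatible G T M)"

definition restr_le ::
  "('a, 'b) monoid_scheme \<Rightarrow> ('a set \<times> 'a set) set \<Rightarrow> 'a set \<times> 'a set \<Rightarrow> 'a set \<times> 'a set \<Rightarrow> bool" where
  "restr_le G T r e \<longleftrightarrow>
     r \<in> T \<and> e \<in> T \<and>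
     (\<exists>K H J. e = (K, H) \<and> subgroup J G \<and> J \<subseteq> H \<and> r = (K \<inter> J, J))"

definition restr_less ::
  "('a, 'b) monoid_scheme \<Rightarrow> ('a set \<times> 'a set) set \<Rightarrow> 'a set \<times> 'a set \<Rightarrow> 'a set \<times> 'a set \<Rightarrow> bool" where
  "restr_less G T r e \<longleftrightarrow> restr_le G T r e \<and> r \<noteq> e"

definition restr_covers ::
  "('a, 'b) monoid_scheme \<Rightarrow> ('a set \<times> 'a set) set \<Rightarrow> 'a set \<times> 'a set \<Rightarrow> 'a set \<times> 'a set \<Rightarrow> bool" where
  "restr_covers G T r e \<longleftrightarrow>
     restr_less G T r e \<and> \<not> (\<exists>s \<in> T. restr_less G T r s \<and> restr_less G T s e)"

text \<open>
  For \<open>r \<le> e\<close> the subgroup \<open>J\<close> is the target of \<open>r\<close>, so the existential below only names the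
  components of \<open>r\<close> and \<open>e\<close>.
\<close>

definition success_le ::
  "('a, 'b) monoid_scheme \<Rightarrow> ('a set \<times> 'a set) set \<Rightarrow> 'a set \<times> 'a set \<Rightarrow> 'a set \<times> 'a set \<Rightarrow> bool" where
  "success_le G T r e \<longleftrightarrow>
     restr_le G T r e \<and>
     (\<exists>K H J. e = (K, H) \<and> r = (K \<inter> J, J) \<and> ((K \<inter> J, K) \<in> T \<longrightarrow> (J, H) \<in> T))"

definition success_less ::
  "('a, 'b) monoid_scheme \<Rightarrow> ('a set \<times> 'a set) set \<Rightarrow> 'a set \<times> 'a set \<Rightarrow> 'a set \<times> 'a set \<Rightarrow> bool" where
  "success_less G T r e \<longleftrightarrow> restr_less G T r e \<and> success_le G T r e"

definition success_covers ::
  "('a, 'b) monoid_scheme \<Rightarrow> ('a set \<times> 'a set) set \<Rightarrow> 'a set \<times> 'a set \<Rightarrow> 'a set \<times> 'a set \<Rightarrow> bool" where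
  "success_covers G T r e \<longleftrightarrow> restr_covers G T r e \<and> success_le G T r e"

end

theory Submission
  imports Defs
begin

text \<open>
  Call a transfer \<open>K \<rightarrow> H\<close> of \<open>T\<close> successful if every subgroup \<open>J\<close> of \<open>H\<close> with
  \<open>K \<inter> J \<rightarrow> K\<close> satisfies \<open>J \<rightarrow> H\<close>. A transfer system \<open>M \<subseteq> T\<close> is compatible with \<open>T\<close> exactly
  when all its members are successful. Since \<open>M\<close> is also closed under restriction, it can only
  contain transfers all of whose restrictions are successful. These hereditarily successful
  transfers already form a transfer system, because success is stable under composition
  (\<open>successful_trans\<close>) and conjugation; hence they are the maximal compatible
  transfer system (\<open>max_compatible_eq\<close>). The recursive formula is a rearrangement of this
  description: it asks that \<open>e\<close> be successful and that its proper restrictions be hereditarily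
  successful.

  For disklike \<open>T\<close> let \<open>e = (K \<rightarrow> H)\<close> pass the test at all covers. The restrictions of \<open>e\<close>
  correspond to the subgroups of \<open>H\<close>, so the covers are the restrictions to maximal subgroups,
  and all proper restrictions of \<open>e\<close> are hereditarily successful. What remains
  (\<open>disklike_success_below\<close>) is that \<open>K \<inter> J \<rightarrow> K\<close> implies \<open>J \<rightarrow> H\<close> for a proper subgroup \<open>J\<close>
  that need not be maximal. Success of the restrictions of \<open>e\<close> gives \<open>J \<rightarrow> L\<close> for every proper
  subgroup \<open>L\<close> of \<open>H\<close> above \<open>J\<close>. Take \<open>L\<close> maximal. A disklike system is made of restrictions of
  transfers to the whole group, so \<open>J \<rightarrow> L\<close> is the restriction of some \<open>Y \<rightarrow> H\<close>. If \<open>Y = H\<close>,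
  then \<open>J = L\<close> is maximal and the test at that cover applies; otherwise \<open>Y\<close> is itself a proper
  subgroup above \<open>J\<close>, and \<open>J \<rightarrow> Y \<rightarrow> H\<close>.
\<close>

section \<open>Conjugation of subsets of a group\<close>

definition (in group) conj_set :: "'a \<Rightarrow> 'a set \<Rightarrow> 'a set" where
  "conj_set g K = g <# K #> inv g"

lemma (in group) conj_set_image:
  "conj_set g K = (\<lambda>x. g \<otimes> x \<otimes> inv g) ` K"
  by (auto simp: conj_set_def l_coset_def r_coset_def)

lemma (in group) conj_set_mono: "K \<subseteq> H \<Longrightarrow> conj_set g K \<subseteq> conj_set g H"
  unfolding conj_set_image by (rule image_mono)

lemma (in group) conj_set_Int:
  assumes "g \<in> carrier G" "K \<subseteq> carrier G" "H \<subseteq> carrier G"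
  shows "conj_set g (K \<inter> H) = conj_set g K \<inter> conj_set g H"
proof -
  have "inj_on (\<lambda>x. g \<otimes> x \<otimes> inv g) (carrier G)"
    using assms(1) by (auto intro!: inj_onI)
  then show ?thesis
    unfolding conj_set_image using assms(2,3) by (rule inj_on_image_Int)
qed

lemma (in group) conj_set_inv_left:
  assumes "g \<in> carrier G" "K \<subseteq> carrier G"
  shows "conj_set (inv g) (conj_set g K) = K"
proof -
  have "inv g \<otimes> (g \<otimes> x \<otimes> inv g) \<otimes> inv (inv g) = x" if "x \<in> K" for x
  proof -
    have x: "x \<in> carrier G" using that assms(2) by blast
    have "inv g \<otimes> (g \<otimes> x \<otimes> inv g) = x \<otimes> inv g"
      using assms(1) x by (metis inv_closed inv_solve_left m_assoc m_closed)
    then show ?thesis using assms(1) x by (simp add: m_assoc)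
  qed
  then show ?thesis by (simp add: conj_set_image image_image)
qed

lemma (in group) conj_set_inv_right:
  assumes "g \<in> carrier G" "K \<subseteq> carrier G"
  shows "conj_set g (conj_set (inv g) K) = K"
  using conj_set_inv_left[of "inv g" K] assms by simp

lemma (in group) conj_set_carrier:
  assumes "g \<in> carrier G"
  shows "conj_set g (carrier G) = carrier G"
proof
  have sub: "conj_set h (carrier G) \<subseteq> carrier G" if "h \<in> carrier G" for h
    using that by (auto simp: conj_set_image)
  then show "conj_set g (carrier G) \<subseteq> carrier G" using assms .
  have "conj_set g (conj_set (inv g) (carrier G)) \<subseteq> conj_set g (carrier G)"
    using sub assms by (intro conj_set_mono) simp
  then show "carrier G \<subseteq> conj_set g (carrier G)"
    using assms by (simp add: conj_set_inv_right)
qed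

section \<open>The largest compatible transfer system\<close>

lemma (in group) transfer_systemI:
  assumes "\<And>K H. (K, H) \<in> M \<Longrightarrow> subgroup K G \<and> subgroup H G \<and> K \<subseteq> H"
    and "\<And>H. subgroup H G \<Longrightarrow> (H, H) \<in> M"
    and "\<And>K H g. (K, H) \<in> M \<Longrightarrow> g \<in> carrier G \<Longrightarrow> (conj_set g K, conj_set g H) \<in> M"
    and "\<And>K H L. (K, H) \<in> M \<Longrightarrow> subgroup L G \<Longrightarrow> L \<subseteq> H \<Longrightarrow> (K \<inter> L, L) \<in> M"
    and "\<And>L K H. (L, K) \<in> M \<Longrightarrow> (K, H) \<in> M \<Longrightarrow> (L, H) \<in> M"
  shows "transfer_system G M"
  unfolding transfer_system_def refl_on_def conj_set_def[symmetric]
proof (intro conjI)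
  show "M \<subseteq> {(K, H). subgroup K G \<and> subgroup H G \<and> K \<subseteq> H}"
    using assms(1) by auto
  show "trans M"
    using assms(5) by (rule transI)
qed (use assms(2-4) in auto)

locale group_transfer_system = group G for G (structure) +
  fixes T :: "('a set \<times> 'a set) set"
  assumes transfer_system: "transfer_system G T"
begin

lemma transferD:
  assumes "(K, H) \<in> T"
  shows "subgroup K G" "subgroup H G" "K \<subseteq> H" "K \<subseteq> carrier G" "H \<subseteq> carrier G"
  using assms transfer_system by (auto simp: transfer_system_def dest: subgroup.subset)

lemma transfer_refl: "subgroup H G \<Longrightarrow> (H, H) \<in> T"
  using transfer_system by (auto simp: transfer_system_def refl_on_def)

lemma transfer_conj:
  "(K, H) \<in> T \<Longrightarrow> g \<in> carrier G \<Longrightarrow> (conj_set g K, conj_set g H) \<in> T"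
  using transfer_system by (simp add: transfer_system_def conj_set_def)

lemma transfer_restrict:
  "(K, H) \<in> T \<Longrightarrow> subgroup L G \<Longrightarrow> L \<subseteq> H \<Longrightarrow> (K \<inter> L, L) \<in> T"
  using transfer_system by (simp add: transfer_system_def)

lemma transfer_trans: "(L, K) \<in> T \<Longrightarrow> (K, H) \<in> T \<Longrightarrow> (L, H) \<in> T"
  using transfer_system by (auto simp: transfer_system_def dest: transD)

lemma subgroup_conj_set:
  "subgroup H G \<Longrightarrow> g \<in> carrier G \<Longrightarrow> subgroup (conj_set g H) G"
  using transfer_conj[OF transfer_refl] transferD(1) by blast

definition successful :: "'a set \<Rightarrow> 'a set \<Rightarrow> bool" where
  "successful K H \<longleftrightarrow>
     (\<forall>J. subgroup J G \<longrightarrow> J \<subseteq> H \<longrightarrow> (K \<inter> J, K) \<in> T \<longrightarrow> (J, H) \<in> T)"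

definition hereditarily_successful :: "('a set \<times> 'a set) set" where
  "hereditarily_successful =
     {(K, H) \<in> T. \<forall>L. subgroup L G \<longrightarrow> L \<subseteq> H \<longrightarrow> successful (K \<inter> L) L}"

lemma successfulD:
  "successful K H \<Longrightarrow> subgroup J G \<Longrightarrow> J \<subseteq> H \<Longrightarrow> (K \<inter> J, K) \<in> T \<Longrightarrow> (J, H) \<in> T"
  by (auto simp: successful_def)

lemma hereditarily_successful_transfer:
  "(K, H) \<in> hereditarily_successful \<Longrightarrow> (K, H) \<in> T"
  by (auto simp: hereditarily_successful_def)

lemma hereditarily_successful_subset: "hereditarily_successful \<subseteq> T"
  by (auto simp: hereditarily_successful_def)

lemma hereditarily_successful_successful:
  assumes "(K, H) \<in> hereditarily_successful"
  shows "successful K H"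
proof -
  have "K \<inter> H = K" "subgroup H G"
    using transferD[OF hereditarily_successful_transfer[OF assms]] by auto
  then show ?thesis using assms by (force simp: hereditarily_successful_def)
qed

lemma hereditarily_successful_restrict:
  assumes "(K, H) \<in> hereditarily_successful" "subgroup L G" "L \<subseteq> H"
  shows "(K \<inter> L, L) \<in> hereditarily_successful"
proof -
  have "successful (K \<inter> L \<inter> L') L'" if "subgroup L' G" "L' \<subseteq> L" for L'
  proof -
    have "K \<inter> L \<inter> L' = K \<inter> L'" using that by auto
    then show ?thesis using assms that by (auto simp: hereditarily_successful_def)
  qed
  then show ?thesis
    using assms transfer_restrict by (auto simp: hereditarily_successful_def)
qed

text \<open>
  Success composes: a subgroup \<open>J\<close> that meets \<open>L\<close> in a transfer is first pushed up along
  \<open>L \<rightarrow> K\<close>, as \<open>K \<inter> J\<close>, and then along \<open>K \<rightarrow> H\<close>.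
\<close>

lemma successful_trans:
  assumes "successful L K" "successful K H" "L \<subseteq> K" "subgroup K G"
  shows "successful L H"
  unfolding successful_def
proof (intro allI impI)
  fix J assume J: "subgroup J G" "J \<subseteq> H" "(L \<inter> J, L) \<in> T"
  have "L \<inter> (K \<inter> J) = L \<inter> J" using assms(3) by auto
  then have "(K \<inter> J, K) \<in> T"
    using successfulD[OF assms(1), of "K \<inter> J"] J subgroups_Inter_pair[OF assms(4) J(1)] by simp
  then show "(J, H) \<in> T" using successfulD[OF assms(2)] J by simp
qed

text \<open>
  Restricting \<open>L \<rightarrow> K \<rightarrow> H\<close> to a subgroup \<open>N\<close> of \<open>H\<close> factors it as \<open>L \<inter> N \<rightarrow> K \<inter> N \<rightarrow> N\<close>, so
  composability of success applies to every restriction of the composite.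
\<close>

lemma hereditarily_successful_trans:
  assumes "(L, K) \<in> hereditarily_successful" "(K, H) \<in> hereditarily_successful"
  shows "(L, H) \<in> hereditarily_successful"
proof -
  note LK = transferD[OF hereditarily_successful_transfer[OF assms(1)]]
  note KH = transferD[OF hereditarily_successful_transfer[OF assms(2)]]
  have "successful (L \<inter> N) N" if N: "subgroup N G" "N \<subseteq> H" for N
  proof -
    have sub: "subgroup (K \<inter> N) G" using subgroups_Inter_pair KH(1) N(1) by simp
    have "L \<inter> (K \<inter> N) = L \<inter> N" using LK(3) by auto
    then have "successful (L \<inter> N) (K \<inter> N)"
      using hereditarily_successful_restrict[OF assms(1) sub]
      by (auto dest: hereditarily_successful_successful)
    moreover have "successful (K \<inter> N) N"
      using hereditarily_successful_restrict[OF assms(2) N]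
      by (rule hereditarily_successful_successful)
    ultimately show ?thesis using successful_trans sub LK(3) by blast
  qed
  moreover have "(L, H) \<in> T"
    using assms hereditarily_successful_transfer transfer_trans by blast
  ultimately show ?thesis by (simp add: hereditarily_successful_def)
qed

text \<open>
  A test subgroup of the conjugated transfer is moved back by \<open>inv g\<close>, where the hypothesis
  decides it, and the resulting transfer is moved forward again by \<open>g\<close>.
\<close>

lemma hereditarily_successful_conj:
  assumes KH: "(K, H) \<in> hereditarily_successful" and g: "g \<in> carrier G"
  shows "(conj_set g K, conj_set g H) \<in> hereditarily_successful"
proof -
  let ?d = "conj_set (inv g)"
  note KHT = hereditarily_successful_transfer[OF KH]
  note sub = transferD[OF KHT] transferD[OF transfer_conj[OF KHT g]]
  have "successful (conj_set g K \<inter> L) L" if L: "subgroup L G" "L \<subseteq> conj_set g H" for L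
    unfolding successful_def
  proof (intro allI impI)
    fix J
    assume J: "subgroup J G" "J \<subseteq> L" "(conj_set g K \<inter> L \<inter> J, conj_set g K \<inter> L) \<in> T"
    note carr = subgroup.subset[OF L(1)] subgroup.subset[OF J(1)]
    have "?d L \<subseteq> H"
      using conj_set_mono[OF L(2), of "inv g"] conj_set_inv_left[OF g sub(5)] by simp
    then have succ: "successful (K \<inter> ?d L) (?d L)"
      using KH subgroup_conj_set[OF L(1)] g by (auto simp: hereditarily_successful_def)
    have "?d (conj_set g K \<inter> L) = K \<inter> ?d L"
      using g sub carr by (simp add: conj_set_Int conj_set_inv_left)
    moreover have "?d (conj_set g K \<inter> L \<inter> J) = ?d (conj_set g K \<inter> L) \<inter> ?d J"
      using g sub carr by (intro conj_set_Int) auto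
    ultimately have "(K \<inter> ?d L \<inter> ?d J, K \<inter> ?d L) \<in> T"
      using transfer_conj[OF J(3), of "inv g"] g by simp
    then have "(?d J, ?d L) \<in> T"
      using successfulD[OF succ subgroup_conj_set[OF J(1)] conj_set_mono[OF J(2)]] g by simp
    from transfer_conj[OF this g] show "(J, L) \<in> T"
      using g carr by (simp add: conj_set_inv_right)
  qed
  then show ?thesis using transfer_conj[OF KHT g] by (simp add: hereditarily_successful_def)
qed

lemma hereditarily_successful_refl:
  assumes "subgroup H G"
  shows "(H, H) \<in> hereditarily_successful"
proof -
  have "successful (H \<inter> L) L" if "L \<subseteq> H" for L
  proof -
    have "H \<inter> L = L" using that by auto
    then show ?thesis by (auto simp: successful_def Int_absorb1)
  qed
  then show ?thesis using transfer_refl[OF assms] by (simp add: hereditarily_successful_def)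
qed

lemma transfer_system_hereditarily_successful:
  "transfer_system G hereditarily_successful"
proof (rule transfer_systemI)
  show "subgroup K G \<and> subgroup H G \<and> K \<subseteq> H" if "(K, H) \<in> hereditarily_successful" for K H
    using transferD[OF hereditarily_successful_transfer[OF that]] by simp
qed (fact hereditarily_successful_refl hereditarily_successful_conj
      hereditarily_successful_restrict hereditarily_successful_trans)+

text \<open>
  Compatibility says that all members of a transfer system are successful; being closed under
  restriction, it then consists of hereditarily successful transfers.
\<close>

lemma max_compatible_eq: "max_compatible G T = hereditarily_successful"
  unfolding max_compatible_def
proof (rule Greatest_equality)
  show "compatible G T hereditarily_successful"
    unfolding compatible_def
  proof (intro conjI allI impI)
    show "(J, H) \<in> T"
      if "subgroup K G \<and> subgroup J G \<and> subgroup H G \<and> K \<subseteq> H \<and> J \<subseteq> H \<and>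
          (K, H) \<in> hereditarily_successful \<and> (K \<inter> J, K) \<in> T" for K J H
      by (rule successfulD[OF hereditarily_successful_successful, of K]) (use that in auto)
  qed (fact transfer_system hereditarily_successful_subset transfer_system_hereditarily_successful)+
next
  fix M assume M: "compatible G T M"
  then interpret M: group_transfer_system G M
    by unfold_locales (simp add: compatible_def)
  have "successful K H" if "(K, H) \<in> M" for K H
    using M that M.transferD(1-3)[OF that] unfolding compatible_def successful_def by blast
  then have "successful (K \<inter> L) L" if "(K, H) \<in> M" "subgroup L G" "L \<subseteq> H" for K H L
    using M.transfer_restrict[OF that] .
  moreover have "M \<subseteq> T" using M by (simp add: compatible_def)
  ultimately show "M \<subseteq> hereditarily_successful"
    unfolding hereditarily_successful_def by blast
qed

section \<open>The recursive formula\<close>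

text \<open>
  Restrictions of a transfer are again in \<open>T\<close>, so the part of the restriction poset below
  \<open>K \<rightarrow> H\<close> is indexed by the subgroups of \<open>H\<close>.
\<close>

lemma restr_le_iff:
  "restr_le G T r (K, H) \<longleftrightarrow>
     (K, H) \<in> T \<and> (\<exists>J. subgroup J G \<and> J \<subseteq> H \<and> r = (K \<inter> J, J))"
  using transfer_restrict by (auto simp: restr_le_def)

lemma success_le_iff:
  "success_le G T (K \<inter> J, J) (K, H) \<longleftrightarrow>
     restr_le G T (K \<inter> J, J) (K, H) \<and> ((K \<inter> J, K) \<in> T \<longrightarrow> (J, H) \<in> T)"
  by (auto simp: success_le_def)

text \<open>
  The step from the recursive to the closed description. The test subgroup \<open>J = H\<close> always
  passes by reflexivity, which is why only proper restrictions have to be examined.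
\<close>

lemma hereditarily_successfulI:
  assumes KH: "(K, H) \<in> T"
    and below: "\<And>J. subgroup J G \<Longrightarrow> J \<subset> H \<Longrightarrow> (K \<inter> J, J) \<in> hereditarily_successful"
    and succ: "\<And>J. subgroup J G \<Longrightarrow> J \<subset> H \<Longrightarrow> (K \<inter> J, K) \<in> T \<Longrightarrow> (J, H) \<in> T"
  shows "(K, H) \<in> hereditarily_successful"
proof -
  note sub = transferD[OF KH]
  have "successful K H"
    unfolding successful_def using succ transfer_refl by blast
  moreover have "K \<inter> H = K" using sub(3) by auto
  ultimately have "successful (K \<inter> L) L" if "subgroup L G" "L \<subseteq> H" for L
    using that hereditarily_successful_successful[OF below[of L]] by (cases "L = H") auto
  then show ?thesis using KH by (simp add: hereditarily_successful_def)
qed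

lemma hereditarily_successful_below:
  assumes e: "e \<in> hereditarily_successful" and r: "restr_le G T r e"
  shows "r \<in> hereditarily_successful \<and> success_le G T r e"
proof -
  obtain K H where KH: "e = (K, H)" by (cases e)
  obtain J where J: "subgroup J G" "J \<subseteq> H" "r = (K \<inter> J, J)"
    using r by (auto simp: KH restr_le_iff)
  note eKH = e[unfolded KH]
  show ?thesis
    using r hereditarily_successful_restrict[OF eKH J(1,2)]
      successfulD[OF hereditarily_successful_successful[OF eKH] J(1,2)]
    by (simp add: KH J(3) success_le_iff)
qed

lemma hereditarily_successful_recursion:
  "hereditarily_successful =
     {e \<in> T. \<forall>r \<in> T. restr_less G T r e \<longrightarrow>
        r \<in> hereditarily_successful \<and> success_less G T r e}" (is "_ = ?R")
proof
  show "hereditarily_successful \<subseteq> ?R"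
    using hereditarily_successful_subset hereditarily_successful_below
    by (auto simp: restr_less_def success_less_def)
next
  show "?R \<subseteq> hereditarily_successful"
  proof
    fix e assume e: "e \<in> ?R"
    obtain K H where KH: "e = (K, H)" by (cases e)
    have KHT: "(K, H) \<in> T" using e KH by simp
    have test: "(K \<inter> J, J) \<in> hereditarily_successful \<and> success_le G T (K \<inter> J, J) (K, H)"
      if J: "subgroup J G" "J \<subset> H" for J
    proof -
      have "(K \<inter> J, J) \<in> T" using transfer_restrict[OF KHT J(1)] J(2) by simp
      moreover have "restr_less G T (K \<inter> J, J) e"
        unfolding KH restr_less_def restr_le_iff using KHT J by blast
      ultimately show ?thesis using e by (simp add: KH success_less_def)
    qed
    then show "e \<in> hereditarily_successful"
      unfolding KH using hereditarily_successfulI[OF KHT] by (simp add: success_le_iff)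
  qed
qed

section \<open>Disklike transfer systems\<close>

text \<open>
  The nontrivial closure property is transitivity: for \<open>U \<inter> (Y \<inter> H) \<rightarrow> Y \<inter> H \<rightarrow> H\<close> with \<open>U\<close> and
  \<open>Y\<close> transferring to \<open>G\<close>, restricting \<open>U \<rightarrow> G\<close> to \<open>Y\<close> gives \<open>U \<inter> Y \<rightarrow> Y \<rightarrow> G\<close>, and the
  composite restricts to \<open>U \<inter> Y \<inter> H \<rightarrow> H\<close>.
\<close>

lemma transfer_system_restrictions_of_disks:
  "transfer_system G {(U \<inter> L, L) | U L. (U, carrier G) \<in> T \<and> subgroup L G}"
    (is "transfer_system G ?D")
proof (rule transfer_systemI)
  have DI: "(U \<inter> L, L) \<in> ?D" if "(U, carrier G) \<in> T" "subgroup L G" for U L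
    using that by blast
  have DE: "\<exists>U. (U, carrier G) \<in> T \<and> subgroup L G \<and> K = U \<inter> L" if "(K, L) \<in> ?D" for K L
    using that by blast
  show "subgroup K G \<and> subgroup H G \<and> K \<subseteq> H" if "(K, H) \<in> ?D" for K H
    using DE[OF that] by (auto dest: transferD(1) subgroups_Inter_pair)
  show "(H, H) \<in> ?D" if H: "subgroup H G" for H
    using DI[OF transfer_refl[OF subgroup_self] H] subgroup.subset[OF H] by (simp add: Int_absorb1)
  show "(conj_set g K, conj_set g H) \<in> ?D"
    if KH: "(K, H) \<in> ?D" and g: "g \<in> carrier G" for K H g
  proof -
    obtain U where U: "(U, carrier G) \<in> T" "subgroup H G" "K = U \<inter> H" using DE[OF KH] by blast
    have "conj_set g K = conj_set g U \<inter> conj_set g H"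
      unfolding U(3) using g transferD(4)[OF U(1)] subgroup.subset[OF U(2)] by (rule conj_set_Int)
    moreover have "(conj_set g U, carrier G) \<in> T"
      using transfer_conj[OF U(1) g] g by (simp add: conj_set_carrier)
    ultimately show ?thesis using DI[OF _ subgroup_conj_set[OF U(2) g]] by simp
  qed
  show "(K \<inter> L, L) \<in> ?D" if KH: "(K, H) \<in> ?D" and L: "subgroup L G" "L \<subseteq> H" for K H L
  proof -
    obtain U where U: "(U, carrier G) \<in> T" "K = U \<inter> H" using DE[OF KH] by blast
    have "K \<inter> L = U \<inter> L" using U L by auto
    then show ?thesis using DI[OF U(1) L(1)] by simp
  qed
  show "(K, H) \<in> ?D" if KB: "(K, B) \<in> ?D" and BH: "(B, H) \<in> ?D" for K B H
  proof -
    obtain U where U: "(U, carrier G) \<in> T" "K = U \<inter> B" using DE[OF KB] by blast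
    obtain Y where Y: "(Y, carrier G) \<in> T" "B = Y \<inter> H" "subgroup H G" using DE[OF BH] by blast
    have "(U \<inter> Y, Y) \<in> T" using transfer_restrict[OF U(1)] transferD[OF Y(1)] by simp
    then have "(U \<inter> Y, carrier G) \<in> T" using Y(1) by (rule transfer_trans)
    moreover have "K = (U \<inter> Y) \<inter> H" using U Y by auto
    ultimately show ?thesis using DI Y(3) by simp
  qed
qed

text \<open>
  The restrictions of transfers to \<open>G\<close> form a transfer system containing the generators, so by
  minimality of the hull there are no others.
\<close>

lemma disklike_transferE:
  assumes "disklike G T" "(K, L) \<in> T"
  obtains U where "(U, carrier G) \<in> T" "K = U \<inter> L"
proof -
  let ?D = "{(U \<inter> L, L) | U L. (U, carrier G) \<in> T \<and> subgroup L G}"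
  obtain S where S: "S \<subseteq> {(H, carrier G) | H. subgroup H G}" "T = transfer_system G hull S"
    using assms(1) by (auto simp: disklike_def)
  have "S \<subseteq> T" unfolding S(2) by (rule hull_subset)
  have "S \<subseteq> ?D"
  proof
    fix s assume s: "s \<in> S"
    then obtain U where U: "s = (U, carrier G)" "subgroup U G" using S(1) by auto
    then have "U \<inter> carrier G = U" using subgroup.subset by blast
    then show "s \<in> ?D" using U s \<open>S \<subseteq> T\<close> subgroup_self by auto
  qed
  then have "T \<subseteq> ?D"
    unfolding S(2) by (rule hull_minimal) (use transfer_system_restrictions_of_disks S(2) in simp)
  then show thesis using assms(2) that by auto
qed

text \<open>
  The property of disklike systems that the cover criterion relies on: transfers extend to
  larger targets. One restricts a disk \<open>U \<rightarrow> G\<close> that induces \<open>J \<rightarrow> L\<close> to \<open>H\<close> instead of \<open>L\<close>.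
\<close>

lemma disklike_extend:
  assumes "disklike G T" "(J, L) \<in> T" "subgroup H G" "L \<subseteq> H"
  obtains Y where "(Y, H) \<in> T" "Y \<inter> L = J"
proof -
  obtain U where U: "(U, carrier G) \<in> T" "J = U \<inter> L"
    using disklike_transferE assms(1,2) by blast
  have "(U \<inter> H, H) \<in> T"
    using transfer_restrict[OF U(1) assms(3)] subgroup.subset[OF assms(3)] by simp
  moreover have "U \<inter> H \<inter> L = J" using U assms(4) by auto
  ultimately show thesis by (rule that)
qed

lemma obtain_maximal_subgroup:
  assumes "finite (carrier G)" "subgroup J G" "J \<subset> H" "subgroup H G"
  obtains L where "subgroup L G" "J \<subseteq> L" "L \<subset> H"
    "\<forall>L'. subgroup L' G \<longrightarrow> L \<subseteq> L' \<longrightarrow> L' \<subset> H \<longrightarrow> L' = L"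
proof -
  let ?P = "{L. subgroup L G \<and> L \<subset> H}"
  have "?P \<subseteq> Pow (carrier G)" using subgroup.subset by auto
  then have "finite ?P" using assms(1) finite_subset by blast
  then obtain L where L: "L \<in> ?P" "J \<subseteq> L" "\<forall>L' \<in> ?P. L \<subseteq> L' \<longrightarrow> L = L'"
    using finite_has_maximal2[of ?P J] assms(2,3) by auto
  show thesis by (rule that[of L]) (use L in auto)
qed

text \<open>
  The restriction \<open>K \<inter> L \<rightarrow> L\<close> remembers its target \<open>L\<close>, so anything strictly between it and
  \<open>K \<rightarrow> H\<close> would give a subgroup strictly between \<open>L\<close> and \<open>H\<close>.
\<close>

lemma restr_covers_maximal:
  assumes KH: "(K, H) \<in> T" and L: "subgroup L G" "L \<subset> H"
    and max: "\<forall>L'. subgroup L' G \<longrightarrow> L \<subseteq> L' \<longrightarrow> L' \<subset> H \<longrightarrow> L' = L"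
  shows "restr_covers G T (K \<inter> L, L) (K, H)"
proof -
  have "K \<inter> H = K" using transferD(3)[OF KH] by auto
  have False if s: "restr_less G T (K \<inter> L, L) s" "restr_less G T s (K, H)" for s
  proof -
    obtain L' where L': "subgroup L' G" "L' \<subseteq> H" "s = (K \<inter> L', L')"
      using s(2) by (auto simp: restr_less_def restr_le_iff)
    have "L' \<noteq> H" using s(2) L'(3) \<open>K \<inter> H = K\<close> by (auto simp: restr_less_def)
    moreover have "L \<subseteq> L'" "L \<noteq> L'"
      using s(1) by (auto simp: L'(3) restr_less_def restr_le_iff)
    ultimately show False using max L' by auto
  qed
  then show ?thesis
    using KH L by (auto simp: restr_covers_def restr_less_def restr_le_iff)
qed

text \<open>
  Success at an arbitrary proper subgroup \<open>J\<close> follows from success at the covers. If the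
  transfer \<open>J \<rightarrow> L\<close> to a maximal subgroup \<open>L\<close> extends to \<open>Y \<rightarrow> H\<close> with \<open>Y\<close> proper, then \<open>Y\<close>
  serves as an intermediate stop between \<open>J\<close> and \<open>H\<close>; if it extends only trivially, then \<open>J\<close> was
  maximal itself.
\<close>

lemma disklike_success_below:
  assumes fin: "finite (carrier G)" and disk: "disklike G T" and KH: "(K, H) \<in> T"
    and covers: "\<And>r. restr_covers G T r (K, H) \<Longrightarrow>
      r \<in> hereditarily_successful \<and> success_le G T r (K, H)"
    and below: "\<And>J. subgroup J G \<Longrightarrow> J \<subset> H \<Longrightarrow> (K \<inter> J, J) \<in> hereditarily_successful"
    and J: "subgroup J G" "J \<subset> H" and KJ: "(K \<inter> J, K) \<in> T"
  shows "(J, H) \<in> T"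
proof -
  note sub = transferD[OF KH]
  \<comment> \<open>The source \<open>K \<inter> J\<close> is unchanged when \<open>K \<inter> J \<rightarrow> K\<close> is restricted to \<open>K \<inter> L\<close>, so \<open>J\<close>
      is a test subgroup for the successful transfer \<open>K \<inter> L \<rightarrow> L\<close>.\<close>
  have up: "(J, L) \<in> T" if L: "subgroup L G" "J \<subseteq> L" "L \<subset> H" for L
  proof -
    have "K \<inter> J \<inter> (K \<inter> L) = K \<inter> J" "K \<inter> L \<inter> J = K \<inter> J" using L(2) by auto
    then have "(K \<inter> L \<inter> J, K \<inter> L) \<in> T"
      using transfer_restrict[OF KJ, of "K \<inter> L"] subgroups_Inter_pair sub(1) L(1) by auto
    then show ?thesis
      using successfulD[OF hereditarily_successful_successful[OF below[OF L(1,3)]] J(1) L(2)] by simp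
  qed
  obtain L where L: "subgroup L G" "J \<subseteq> L" "L \<subset> H"
    and max: "\<forall>L'. subgroup L' G \<longrightarrow> L \<subseteq> L' \<longrightarrow> L' \<subset> H \<longrightarrow> L' = L"
    by (rule obtain_maximal_subgroup[OF fin J sub(2)])
  obtain Y where Y: "(Y, H) \<in> T" "Y \<inter> L = J"
    using disklike_extend[OF disk up[OF L] sub(2)] L(3) by auto
  show ?thesis
  proof (cases "Y = H")
    case True
    then have "J = L" using Y L by auto
    moreover have "success_le G T (K \<inter> L, L) (K, H)"
      using covers restr_covers_maximal[OF KH L(1,3) max] by blast
    ultimately show ?thesis using KJ by (simp add: success_le_iff)
  next
    case False
    then have "(J, Y) \<in> T" using up[of Y] Y transferD[OF Y(1)] by auto
    then show ?thesis using Y(1) by (rule transfer_trans)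
  qed
qed

lemma hereditarily_successful_cover_recursion:
  assumes fin: "finite (carrier G)" and disk: "disklike G T"
  shows "hereditarily_successful =
     {e \<in> T. \<forall>r \<in> T. restr_covers G T r e \<longrightarrow>
        r \<in> hereditarily_successful \<and> success_covers G T r e}" (is "_ = ?R")
proof
  show "hereditarily_successful \<subseteq> ?R"
    using hereditarily_successful_subset hereditarily_successful_below
    by (auto simp: restr_covers_def restr_less_def success_covers_def)
next
  show "?R \<subseteq> hereditarily_successful"
  proof
    fix e assume e: "e \<in> ?R"
    obtain K H where KH: "e = (K, H)" by (cases e)
    have KHT: "(K, H) \<in> T" using e KH by simp
    have covers: "r \<in> hereditarily_successful \<and> success_le G T r (K, H)"
      if "restr_covers G T r (K, H)" for r
      using e that
      unfolding KH restr_covers_def restr_less_def restr_le_def success_covers_def by blast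
    \<comment> \<open>By finiteness every proper restriction lies below a cover, and hereditary success is
        inherited by restrictions.\<close>
    have below: "(K \<inter> J, J) \<in> hereditarily_successful" if J: "subgroup J G" "J \<subset> H" for J
    proof -
      obtain L where L: "subgroup L G" "J \<subseteq> L" "L \<subset> H"
        and max: "\<forall>L'. subgroup L' G \<longrightarrow> L \<subseteq> L' \<longrightarrow> L' \<subset> H \<longrightarrow> L' = L"
        by (rule obtain_maximal_subgroup[OF fin J transferD(2)[OF KHT]])
      have "(K \<inter> L, L) \<in> hereditarily_successful"
        using covers restr_covers_maximal[OF KHT L(1,3) max] by blast
      from hereditarily_successful_restrict[OF this J(1) L(2)]
      have "(K \<inter> L \<inter> J, J) \<in> hereditarily_successful" .
      moreover have "K \<inter> L \<inter> J = K \<inter> J" using L(2) by auto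
      ultimately show ?thesis by simp
    qed
    show "e \<in> hereditarily_successful"
      unfolding KH
      using KHT below disklike_success_below[OF fin disk KHT covers below]
      by (rule hereditarily_successfulI)
  qed
qed

end

theorem theorem1p1:
  fixes G :: "('a, 'b) monoid_scheme" and T :: "('a set \<times> 'a set) set"
  assumes "group G" and "finite (carrier G)" and "transfer_system G T"
  shows "max_compatible G T =
           {e \<in> T. \<forall>r \<in> T. restr_less G T r e \<longrightarrow>
              r \<in> max_compatible G T \<and> success_less G T r e} \<and>
         (disklike G T \<longrightarrow>
           max_compatible G T =
             {e \<in> T. \<forall>r \<in> T. restr_covers G T r e \<longrightarrow>
                r \<in> max_compatible G T \<and> success_covers G T r e})"
proof -
  interpret group G by fact
  interpret group_transfer_system G T by unfold_locales fact
  show ?thesis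
    unfolding max_compatible_eq
    using hereditarily_successful_recursion hereditarily_successful_cover_recursion[OF assms(2)]
    by blast
qed

end
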